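(* Let $\{(z^k,y^k)\}_{k\in\mathbb N}$ be a sequence generated by the simplified (ergodic) version of FLAG described in the context. Suppose that $\sigma>0$ and $0\preceq P\preceq(\sigma/2)I_n$. Then, for any optimal solution $z^*$ of problem (P) and every integer $N\ge1$, the ergodic sequence $\bar z^N=t_{N-1}^{-2}\sum_{k=0}^{N-1}t_kz^{k+1}$ satisfies $$\Psi(\bar z^N)-\Psi(z^* )\le\frac{B_{\rho,c}(z^* )}{2N^2},\qquad \|\mathcal A\bar z^N-b\|\le\frac{B_{\rho,c}(z^* )}{cN^2},$$ where $B_{\rho,c}(z^* ):=4\left(\|z^*-z^0\|_P^2+\frac{1}{\mu\rho}(\|y^0\|+c)^2\right)$.
   Context: **Problem.** Let $\Psi:\mathbb R^n\to(-\infty,+\infty]$ be proper, lower semicontinuous and $\sigma$-strongly convex with $\sigma\ge 0$ ($\sigma=0$ means merely convex), $\mathcal A:\mathbb R^n\to\mathbb R^m$ linear, $b\in\mathbb R^m$. Problem (P) is $\min\{\Psi(x):\mathcal A x=b,\ x\in\mathbb R^n\}$, with feasible set $\mathcal F=\{x\in\mathbb R^n:\mathcal A x=b\}$. The Lagrangian is $\mathcal L(x,y)=\Psi(x)+\langle y,\mathcal A x-b\rangle$ and, for $\rho\geq 0$, the augmented Lagrangian is $\mathcal L_\rho(x,y)=\mathcal L(x,y)+\frac{\rho}{2}\|\mathcal A x-b\|^2$. Standing assumption: $\mathcal L$ has a saddle point, i.e. there is $(x^*,y^* )$ with $\mathcal L(x^*,y)\le\mathcal L(x^*,y^* )\le\mathcal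 L(x,y^* )$ for all $x\in\mathbb R^n,y\in\mathbb R^m$. The dual problem is to maximize $\inf_x\mathcal L(x,y)$ over $y\in\mathbb R^m$. The constant $c>0$ is such that $c\ge 2\|y^*\|$, where $y^*$ is an optimal solution of the dual problem. **Notation.** $\mathbb S_+^n$ is the set of $n\times n$ symmetric positive semidefinite matrices; for $P\in\mathbb S_+^n$, $\|u\|_P=\sqrt{\langle u,Pu\rangle}$ and $\Delta_P(u,v,w)=\frac12(\|u-v\|_P^2-\|u-w\|_P^2)$. **Nice primal algorithmic map.** Given $\rho,t>0$, let $\rho_t=\rho,\tau_t=1$ if $\sigma=0$, and $\rho_t=\rho t,\tau_t=t$ if $\sigma>0$. A (possibly set-valued) map $\mathrm{Prim}_t$ on $\mathbb R^n\times\mathbb R^m$ with values in $\mathbb R^n$ is nice with $\delta\in(0,1]$ and $P,Q\in\mathbb S_+^n$ if for all $(z,\lambda)$, all $z^+\in\mathrm{Prim}_t(z,\lambda)$ and all $\xi\in\mathcal F$, $$\mathcal L_{\rho_t}(z^+,\lambda)-\mathcal L_{\rho_t}(\xi,\lambda)\le\tau_t\Delta_P(\xi,z,z^+)-\frac{\tau_t}{2}\|z^+-z\|_Q^2-\frac{\sigma}{2}\|\xi-z^+\|^2-\frac{\delta\rho_t}{2}\|\mathcal A z^+-b\|^2.$$ **Simplified (ergodic) FLAG, case $\sigma>0$.** Input: maps $\mathrm{Prim}_{t_k}$ that are nice with the same $\delta,P,Q$ for all $k$. Choose $\mu\in(0,1+\delta]$, $\rho>0$, any $(z^0,y^0)\in\mathbb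 R^n\times\mathbb R^m$, $t_0=1$. For $k\ge0$ let $\rho_k=\rho t_k$ and $$z^{k+1}\in\mathrm{Prim}_{t_k}(z^k,y^k),\quad y^{k+1}=y^k+\mu\rho_k(\mathcal A z^{k+1}-b),\quad t_{k+1}=\frac{1+\sqrt{1+4t_k^2}}{2}.$$ *)

theory Defs
  imports "HOL-Analysis.Analysis"
begin

section \<open>Extended-real-valued convex functions\<close>

definition proper :: "('a \<Rightarrow> ereal) \<Rightarrow> bool" where
  "proper f \<longleftrightarrow> (\<forall>x. f x \<noteq> -\<infinity>) \<and> (\<exists>x. f x \<noteq> \<infinity>)"

definition lower_semicontinuous :: "('a::topological_space \<Rightarrow> ereal) \<Rightarrow> bool" where
  "lower_semicontinuous f \<longleftrightarrow> (\<forall>x. f x \<le> Liminf (at x) f)"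

text \<open>For \<open>\<sigma> = 0\<close> this is convexity. At the end points \<open>u = 0\<close> and \<open>u = 1\<close> the
  inequality is trivial, since \<open>0 * \<infinity> = 0\<close> in \<^typ>\<open>ereal\<close>.\<close>

definition strongly_convex :: "real \<Rightarrow> ('a::real_inner \<Rightarrow> ereal) \<Rightarrow> bool" where
  "strongly_convex \<sigma> f \<longleftrightarrow>
     (\<forall>x y. \<forall>u\<in>{0..1::real}.
        f (u *\<^sub>R x + (1 - u) *\<^sub>R y) + ereal (\<sigma> / 2 * u * (1 - u) * (norm (x - y))\<^sup>2)
          \<le> ereal u * f x + ereal (1 - u) * f y)"

section \<open>Positive semidefinite matrices\<close>

definition psd :: "real^'n^'n \<Rightarrow> bool" where
  "psd P \<longleftrightarrow> transpose P = P \<and> (\<forall>u. 0 \<le> u \<bullet> (P *v u))"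

definition loewner_le :: "real^'n^'n \<Rightarrow> real^'n^'n \<Rightarrow> bool" where
  "loewner_le P Q \<longleftrightarrow> psd (Q - P)"

definition norm_mat :: "real^'n^'n \<Rightarrow> real^'n \<Rightarrow> real" where
  "norm_mat P u = sqrt (u \<bullet> (P *v u))"

definition Delta :: "real^'n^'n \<Rightarrow> real^'n \<Rightarrow> real^'n \<Rightarrow> real^'n \<Rightarrow> real" where
  "Delta P u v w = ((norm_mat P (u - v))\<^sup>2 - (norm_mat P (u - w))\<^sup>2) / 2"

section \<open>The linearly constrained problem: minimize \<open>\<Psi> x\<close> subject to \<open>A x = b\<close>\<close>

definition feasible :: "(real^'n \<Rightarrow> real^'m) \<Rightarrow> real^'m \<Rightarrow> (real^'n) set" where
  "feasible A b = {x. A x = b}"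

definition optimal_solution ::
  "(real^'n \<Rightarrow> ereal) \<Rightarrow> (real^'n \<Rightarrow> real^'m) \<Rightarrow> real^'m \<Rightarrow> real^'n \<Rightarrow> bool" where
  "optimal_solution \<Psi> A b x \<longleftrightarrow> x \<in> feasible A b \<and> (\<forall>\<xi>\<in>feasible A b. \<Psi> x \<le> \<Psi> \<xi>)"

definition Lagrangian ::
  "(real^'n \<Rightarrow> ereal) \<Rightarrow> (real^'n \<Rightarrow> real^'m) \<Rightarrow> real^'m \<Rightarrow> real^'n \<Rightarrow> real^'m \<Rightarrow> ereal" where
  "Lagrangian \<Psi> A b x y = \<Psi> x + ereal (y \<bullet> (A x - b))"

definition aug_Lagrangian ::
  "(real^'n \<Rightarrow> ereal) \<Rightarrow> (real^'n \<Rightarrow> real^'m) \<Rightarrow> real^'m \<Rightarrow> real \<Rightarrow> real^'n \<Rightarrow> real^'m \<Rightarrow> ereal" where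
  "aug_Lagrangian \<Psi> A b \<rho> x y = Lagrangian \<Psi> A b x y + ereal (\<rho> / 2 * (norm (A x - b))\<^sup>2)"

definition saddle_point ::
  "(real^'n \<Rightarrow> ereal) \<Rightarrow> (real^'n \<Rightarrow> real^'m) \<Rightarrow> real^'m \<Rightarrow> real^'n \<Rightarrow> real^'m \<Rightarrow> bool" where
  "saddle_point \<Psi> A b xs ys \<longleftrightarrow>
     (\<forall>x y. Lagrangian \<Psi> A b xs y \<le> Lagrangian \<Psi> A b xs ys \<and>
            Lagrangian \<Psi> A b xs ys \<le> Lagrangian \<Psi> A b x ys)"

definition dual_function ::
  "(real^'n \<Rightarrow> ereal) \<Rightarrow> (real^'n \<Rightarrow> real^'m) \<Rightarrow> real^'m \<Rightarrow> real^'m \<Rightarrow> ereal" where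
  "dual_function \<Psi> A b y = (INF x. Lagrangian \<Psi> A b x y)"

definition dual_optimal_solution ::
  "(real^'n \<Rightarrow> ereal) \<Rightarrow> (real^'n \<Rightarrow> real^'m) \<Rightarrow> real^'m \<Rightarrow> real^'m \<Rightarrow> bool" where
  "dual_optimal_solution \<Psi> A b ys \<longleftrightarrow> (\<forall>y. dual_function \<Psi> A b y \<le> dual_function \<Psi> A b ys)"

section \<open>Nice primal algorithmic maps and the ergodic FLAG method\<close>

definition rho_par :: "real \<Rightarrow> real \<Rightarrow> real \<Rightarrow> real" where
  "rho_par \<sigma> \<rho> t = (if \<sigma> = 0 then \<rho> else \<rho> * t)"

definition tau_par :: "real \<Rightarrow> real \<Rightarrow> real" where
  "tau_par \<sigma> t = (if \<sigma> = 0 then 1 else t)"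

text \<open>\<open>Prim\<close> is the (set-valued) map for the one parameter value \<open>t\<close>; the set of values may be
  empty. The left-hand side is a difference in \<^typ>\<open>ereal\<close>, where \<open>r - \<infinity> = -\<infinity>\<close> for real \<open>r\<close>, but
  \<open>\<infinity> - \<infinity> = \<infinity>\<close>. As soon as some \<open>\<xi>\<close> is feasible with \<open>\<Psi> \<xi> < \<infinity>\<close>, the inequality at this \<open>\<xi>\<close>
  forces \<open>\<Psi> z' < \<infinity>\<close>, and then it holds trivially at all feasible \<open>\<xi>\<close> with \<open>\<Psi> \<xi> = \<infinity>\<close>.\<close>

definition nice_primal_map ::
  "(real^'n \<Rightarrow> ereal) \<Rightarrow> real \<Rightarrow> (real^'n \<Rightarrow> real^'m) \<Rightarrow> real^'m \<Rightarrow> real \<Rightarrow> real \<Rightarrow>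
   real \<Rightarrow> real^'n^'n \<Rightarrow> real^'n^'n \<Rightarrow> (real^'n \<Rightarrow> real^'m \<Rightarrow> (real^'n) set) \<Rightarrow> bool" where
  "nice_primal_map \<Psi> \<sigma> A b \<rho> t \<delta> P Q Prim \<longleftrightarrow>
     0 < \<delta> \<and> \<delta> \<le> 1 \<and> psd P \<and> psd Q \<and>
     (\<forall>z y. \<forall>z'\<in>Prim z y. \<forall>\<xi>\<in>feasible A b.
        aug_Lagrangian \<Psi> A b (rho_par \<sigma> \<rho> t) z' y - aug_Lagrangian \<Psi> A b (rho_par \<sigma> \<rho> t) \<xi> y
        \<le> ereal (tau_par \<sigma> t * Delta P \<xi> z z'
                 - tau_par \<sigma> t / 2 * (norm_mat Q (z' - z))\<^sup>2
                 - \<sigma> / 2 * (norm (\<xi> - z'))\<^sup>2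
                 - \<delta> * rho_par \<sigma> \<rho> t / 2 * (norm (A z' - b))\<^sup>2))"

primrec flag_t :: "nat \<Rightarrow> real" where
  "flag_t 0 = 1"
| "flag_t (Suc k) = (1 + sqrt (1 + 4 * (flag_t k)\<^sup>2)) / 2"

text \<open>The iterates for \<open>\<sigma> > 0\<close>, from arbitrary starting points \<open>z 0\<close> and \<open>y 0\<close>;
  \<open>Prim t\<close> is the primal map for the parameter value \<open>t\<close>.\<close>

definition ergodic_flag_sequence ::
  "(real^'n \<Rightarrow> real^'m) \<Rightarrow> real^'m \<Rightarrow> (real \<Rightarrow> real^'n \<Rightarrow> real^'m \<Rightarrow> (real^'n) set) \<Rightarrow>
   real \<Rightarrow> real \<Rightarrow> (nat \<Rightarrow> real^'n) \<Rightarrow> (nat \<Rightarrow> real^'m) \<Rightarrow> bool" where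
  "ergodic_flag_sequence A b Prim \<mu> \<rho> z y \<longleftrightarrow>
     (\<forall>k. z (Suc k) \<in> Prim (flag_t k) (z k) (y k) \<and>
          y (Suc k) = y k + (\<mu> * (\<rho> * flag_t k)) *\<^sub>R (A (z (Suc k)) - b))"

definition ergodic_mean :: "(nat \<Rightarrow> real^'n) \<Rightarrow> nat \<Rightarrow> real^'n" where
  "ergodic_mean z N = (1 / (flag_t (N - 1))\<^sup>2) *\<^sub>R (\<Sum>k<N. flag_t k *\<^sub>R z (Suc k))"

definition B_const ::
  "real^'n^'n \<Rightarrow> real \<Rightarrow> real \<Rightarrow> real \<Rightarrow> real^'n \<Rightarrow> real^'m \<Rightarrow> real^'n \<Rightarrow> real" where
  "B_const P \<mu> \<rho> c z0 y0 \<xi> =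
     4 * ((norm_mat P (\<xi> - z0))\<^sup>2 + 1 / (\<mu> * \<rho>) * (norm y0 + c)\<^sup>2)"

end

theory Submission
  imports Defs
begin

text \<open>
  The proof is an energy argument. Write \<open>t\<^sub>k\<close> for \<open>flag_t k\<close> and \<open>r\<^sub>k\<close> for the residual \<open>A (z k) - b\<close>.
  At the optimal solution \<open>zs\<close>, the inequality of the nice primal map bounds
  \<open>\<Psi> (z (k+1)) - \<Psi> zs + y k \<bullet> r\<^sub>k\<^sub>+\<^sub>1\<close>. The multiplier update allows \<open>y k\<close> to be replaced by an arbitrary
  \<open>v\<close>, at the cost of a telescoping difference of \<open>(norm (v - y k))\<^sup>2\<close> and of a multiple of
  \<open>(norm r\<^sub>k\<^sub>+\<^sub>1)\<^sup>2\<close>, which the primal inequality absorbs exactly when \<open>\<mu> \<le> 1 + \<delta>\<close>. Multiplied by \<open>t\<^sub>k\<close>,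
  the terms in \<open>v\<close> telescope with a constant weight, while the proximal terms carry the growing
  weight \<open>t\<^sub>k\<^sup>2 / 2\<close>. The increase of this weight, \<open>t\<^sub>k\<^sub>+\<^sub>1 / 2 \<le> t\<^sub>k\<close>, is paid for by strong
  convexity, because \<open>P \<preceq> (\<sigma> / 2) I\<close>. This is \<open>flag_energy_decrease\<close>.

  Summation and Jensen's inequality with the weights \<open>t\<^sub>k\<close>, whose sum over \<open>k < N\<close> is
  \<open>t\<^sub>N\<^sub>-\<^sub>1\<^sup>2 \<ge> N\<^sup>2 / 4\<close>, give an \<open>O(1/N\<^sup>2)\<close> bound on \<open>\<Psi> x - \<Psi> zs + v \<bullet> (A x - b)\<close> at the ergodic
  mean \<open>x\<close>, for every multiplier \<open>v\<close> (\<open>ergodic_mean_Lagrangian_bound\<close>). If \<open>A x \<noteq> b\<close>, the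
  choice of \<open>v\<close> as the vector of norm \<open>c\<close> in the direction of \<open>A x - b\<close> turns the left-hand side into
  \<open>\<Psi> x - \<Psi> zs + c * norm (A x - b)\<close>, which already bounds the objective gap. For the residual,
  strong duality bounds the gap from below by
  \<open>- norm ys * norm (A x - b) \<ge> - (c / 2) * norm (A x - b)\<close>
  (\<open>optimal_value_le_Lagrangian\<close>), so that half of the residual term survives.
\<close>

section \<open>The step parameters\<close>

lemma flag_t_ge: "flag_t k \<ge> (real k + 2) / 2"
proof (induction k)
  case (Suc k)
  have "2 * flag_t k \<le> sqrt (1 + 4 * (flag_t k)\<^sup>2)"
    by (rule real_le_rsqrt) (simp add: power_mult_distrib)
  then show ?case using Suc by (simp add: field_simps)
qed simp

lemma flag_t_ge_1: "flag_t k \<ge> 1"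
  using flag_t_ge[of k] by simp

lemma flag_t_pos: "flag_t k > 0"
  using flag_t_ge_1[of k] by simp

lemma flag_t_Suc_square: "(flag_t (Suc k))\<^sup>2 = (flag_t k)\<^sup>2 + flag_t (Suc k)"
proof -
  have "(sqrt (1 + 4 * (flag_t k)\<^sup>2))\<^sup>2 = 1 + 4 * (flag_t k)\<^sup>2"
    by (simp add: add_nonneg_nonneg)
  then show ?thesis
    by (simp add: power2_eq_square field_simps)
qed

lemma flag_t_Suc_le: "flag_t (Suc k) \<le> 2 * flag_t k"
proof -
  have "sqrt (1 + 4 * (flag_t k)\<^sup>2) \<le> 1 + 2 * flag_t k"
    using flag_t_pos[of k] by (intro real_le_lsqrt) (auto simp: power2_eq_square algebra_simps)
  then show ?thesis using flag_t_ge_1[of k] by simp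
qed

lemma sum_flag_t: "(\<Sum>k<Suc n. flag_t k) = (flag_t n)\<^sup>2"
proof (induction n)
  case (Suc n)
  then show ?case using flag_t_Suc_square[of n] by simp
qed simp

section \<open>Matrix seminorms and convexity\<close>

lemma norm_mat_square: "psd P \<Longrightarrow> (norm_mat P u)\<^sup>2 = u \<bullet> (P *v u)"
  by (simp add: norm_mat_def psd_def)

lemma norm_mat_square_le:
  assumes "psd P" and "loewner_le P (a *\<^sub>R mat 1)"
  shows "(norm_mat P u)\<^sup>2 \<le> a * (norm u)\<^sup>2"
proof -
  have "0 \<le> u \<bullet> ((a *\<^sub>R mat 1 - P) *v u)"
    using assms(2) by (simp add: loewner_le_def psd_def)
  also have "\<dots> = a * (norm u)\<^sup>2 - u \<bullet> (P *v u)"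
    by (simp add: matrix_vector_mult_diff_rdistrib scaleR_matrix_vector_assoc[symmetric]
        inner_diff_right power2_norm_eq_inner)
  finally show ?thesis using norm_mat_square[OF assms(1)] by simp
qed

text \<open>Jensen's inequality for finite sums is about real-valued functions; it becomes applicable to an
  extended-real-valued function by restriction to its effective domain.\<close>

lemma strongly_convex_imp_convex_on_domain:
  assumes "strongly_convex \<sigma> f" and "0 \<le> \<sigma>" and "\<And>x. f x \<noteq> -\<infinity>"
  shows "convex_on {x. f x \<noteq> \<infinity>} (\<lambda>x. real_of_ereal (f x))"
proof -
  let ?D = "{x. f x \<noteq> \<infinity>}"
  have real: "f x = ereal (real_of_ereal (f x))" if "x \<in> ?D" for x
    using that assms(3)[of x] by (cases "f x") auto
  have le: "f (u *\<^sub>R x + v *\<^sub>R w) \<le> ereal (u * real_of_ereal (f x) + v * real_of_ereal (f w))"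
    if "x \<in> ?D" "w \<in> ?D" "0 \<le> u" "0 \<le> v" "u + v = 1" for x w u v
  proof -
    have v: "v = 1 - u" using that by simp
    have "f (u *\<^sub>R x + v *\<^sub>R w) \<le>
        f (u *\<^sub>R x + v *\<^sub>R w) + ereal (\<sigma> / 2 * u * v * (norm (x - w))\<^sup>2)"
      using that assms(2) by (simp add: ereal_le_add_self)
    also have "\<dots> \<le> ereal u * f x + ereal v * f w"
      using assms(1) that unfolding strongly_convex_def v by simp
    also have "\<dots> = ereal (u * real_of_ereal (f x) + v * real_of_ereal (f w))"
      by (subst real[OF that(1)], subst real[OF that(2)]) simp
    finally show ?thesis .
  qed
  have mem: "u *\<^sub>R x + v *\<^sub>R w \<in> ?D"
    if "x \<in> ?D" "w \<in> ?D" "0 \<le> u" "0 \<le> v" "u + v = 1" for x w u v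
    using le[OF that] by auto
  show ?thesis
    unfolding convex_on_def
  proof (intro conjI ballI allI impI)
    show "convex ?D" unfolding convex_def using mem by blast
    fix x w u v assume *: "x \<in> ?D" "w \<in> ?D" "0 \<le> u" "0 \<le> v" "u + v = (1::real)"
    show "real_of_ereal (f (u *\<^sub>R x + v *\<^sub>R w)) \<le> u * real_of_ereal (f x) + v * real_of_ereal (f w)"
      using le[OF *] real[OF mem[OF *]] by (metis ereal_less_eq(3))
  qed
qed

section \<open>Strong duality from a saddle point\<close>

text \<open>Since \<open>Lagrangian \<Psi> A b x'\<close> is affine in the multiplier and attains its maximum, its slope
  \<open>A x' - b\<close> vanishes; it is enough to move the multiplier by the slope itself.\<close>

lemma saddle_point_feasible_finite:
  assumes "proper \<Psi>" and "saddle_point \<Psi> A b x' y'"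
  shows "A x' = b" and "\<Psi> x' \<noteq> \<infinity>" and "\<Psi> x' \<le> dual_function \<Psi> A b y'"
proof -
  have max: "Lagrangian \<Psi> A b x' y \<le> Lagrangian \<Psi> A b x' y'"
    and min: "Lagrangian \<Psi> A b x' y' \<le> Lagrangian \<Psi> A b x y'" for x y
    using assms(2) by (auto simp: saddle_point_def)
  obtain x where "\<Psi> x \<noteq> \<infinity>" using assms(1) by (auto simp: proper_def)
  then show fin: "\<Psi> x' \<noteq> \<infinity>"
    using min[of x] by (auto simp: Lagrangian_def)
  then obtain p where p: "\<Psi> x' = ereal p"
    using assms(1) by (cases "\<Psi> x'") (auto simp: proper_def)
  have "(A x' - b) \<bullet> (A x' - b) \<le> 0"
    using max[of "y' + (A x' - b)"] by (simp add: Lagrangian_def p inner_add_left)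
  then have "A x' - b = 0" using inner_gt_zero_iff[of "A x' - b"] by linarith
  then show Ax: "A x' = b" by simp
  show "\<Psi> x' \<le> dual_function \<Psi> A b y'"
    unfolding dual_function_def
    using min by (auto intro!: INF_greatest simp: Lagrangian_def Ax)
qed

text \<open>Any dual optimal \<open>ys\<close> serves, not just the dual part of a saddle point: its dual value is at
  least that of \<open>y'\<close>, which is at least the value of the feasible point \<open>x'\<close>.\<close>

lemma optimal_value_le_Lagrangian:
  assumes "proper \<Psi>" and "saddle_point \<Psi> A b x' y'"
    and "dual_optimal_solution \<Psi> A b ys" and "optimal_solution \<Psi> A b zs"
  shows "\<Psi> zs \<noteq> \<infinity>" and "\<Psi> zs \<le> Lagrangian \<Psi> A b x ys"
proof -
  note sp = saddle_point_feasible_finite[OF assms(1,2)]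
  have le: "\<Psi> zs \<le> \<Psi> x'"
    using assms(4) sp(1) by (simp add: optimal_solution_def feasible_def)
  then show "\<Psi> zs \<noteq> \<infinity>" using sp(2) by auto
  note le
  also note sp(3)
  also have "dual_function \<Psi> A b y' \<le> dual_function \<Psi> A b ys"
    using assms(3) by (simp add: dual_optimal_solution_def)
  also have "\<dots> \<le> Lagrangian \<Psi> A b x ys"
    unfolding dual_function_def by (rule INF_lower) simp
  finally show "\<Psi> zs \<le> Lagrangian \<Psi> A b x ys" .
qed

section \<open>Energy decrease in one iteration\<close>

text \<open>The polarization identity for the multiplier step \<open>y + s r\<close>, solved for \<open>v \<bullet> r\<close>: it exchanges
  the current multiplier for an arbitrary one.\<close>

lemma multiplier_step_identity:
  fixes v y r :: "'a::real_inner"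
  assumes "s > 0"
  shows "v \<bullet> r = y \<bullet> r
    + ((norm (v - y))\<^sup>2 - (norm (v - (y + s *\<^sub>R r)))\<^sup>2) / (2 * s) + s / 2 * (norm r)\<^sup>2"
proof -
  have "(norm (v - (y + s *\<^sub>R r)))\<^sup>2
      = (norm (v - y))\<^sup>2 - 2 * s * ((v - y) \<bullet> r) + s\<^sup>2 * (norm r)\<^sup>2"
    unfolding power2_norm_eq_inner by (simp add: algebra_simps inner_commute power2_eq_square)
  then show ?thesis
    using assms by (simp add: field_simps power2_eq_square inner_diff_left)
qed

text \<open>The comparison point \<open>\<xi>\<close> is feasible and has a finite value, so the inequality in
  \<open>nice_primal_map\<close> forces \<open>\<Psi> z'\<close> to be finite and becomes an inequality between reals. The
  penalty term of the augmented Lagrangian joins the \<open>\<delta>\<close> term, which produces the factor \<open>1 + \<delta>\<close>.\<close>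

lemma nice_primal_map_finite_estimate:
  assumes nice: "nice_primal_map \<Psi> \<sigma> A b \<rho> t \<delta> P Q Prim" and "\<sigma> > 0" and "t \<ge> 0"
    and z': "z' \<in> Prim z y" and \<xi>: "A \<xi> = b" "\<Psi> \<xi> = ereal p" and ninf: "\<Psi> z' \<noteq> -\<infinity>"
  obtains q where "\<Psi> z' = ereal q"
    and "q - p + y \<bullet> (A z' - b) \<le> t * Delta P \<xi> z z' - \<sigma> / 2 * (norm (\<xi> - z'))\<^sup>2
           - (1 + \<delta>) * (\<rho> * t) / 2 * (norm (A z' - b))\<^sup>2"
proof -
  have "aug_Lagrangian \<Psi> A b (\<rho> * t) z' y - aug_Lagrangian \<Psi> A b (\<rho> * t) \<xi> y
        \<le> ereal (t * Delta P \<xi> z z' - t / 2 * (norm_mat Q (z' - z))\<^sup>2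
            - \<sigma> / 2 * (norm (\<xi> - z'))\<^sup>2 - \<delta> * (\<rho> * t) / 2 * (norm (A z' - b))\<^sup>2)"
    using nice z' \<xi>(1) \<open>\<sigma> > 0\<close> unfolding nice_primal_map_def feasible_def rho_par_def tau_par_def
    by auto
  then have *: "\<Psi> z' + ereal (y \<bullet> (A z' - b)) + ereal (\<rho> * t / 2 * (norm (A z' - b))\<^sup>2) - ereal p
        \<le> ereal (t * Delta P \<xi> z z' - t / 2 * (norm_mat Q (z' - z))\<^sup>2
            - \<sigma> / 2 * (norm (\<xi> - z'))\<^sup>2 - \<delta> * (\<rho> * t) / 2 * (norm (A z' - b))\<^sup>2)"
    by (simp add: aug_Lagrangian_def Lagrangian_def \<xi>)
  then obtain q where q: "\<Psi> z' = ereal q"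
    using ninf by (cases "\<Psi> z'") auto
  have "q + y \<bullet> (A z' - b) + \<rho> * t / 2 * (norm (A z' - b))\<^sup>2 - p
      \<le> t * Delta P \<xi> z z' - t / 2 * (norm_mat Q (z' - z))\<^sup>2
            - \<sigma> / 2 * (norm (\<xi> - z'))\<^sup>2 - \<delta> * (\<rho> * t) / 2 * (norm (A z' - b))\<^sup>2"
    using * by (simp add: q)
  moreover have "0 \<le> t / 2 * (norm_mat Q (z' - z))\<^sup>2" using \<open>t \<ge> 0\<close> by simp
  ultimately have "q - p + y \<bullet> (A z' - b) \<le> t * Delta P \<xi> z z' - \<sigma> / 2 * (norm (\<xi> - z'))\<^sup>2
           - (1 + \<delta>) * (\<rho> * t) / 2 * (norm (A z' - b))\<^sup>2"
    by (simp add: algebra_simps add_divide_distrib)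
  with q show ?thesis by (rule that)
qed

text \<open>The parameter \<open>s\<close> stands for \<open>\<mu> * \<rho>\<close>. The multiplier part has a constant weight: the factor
  \<open>t\<^sub>k\<close> by which an iteration is weighted cancels the one in the dual step size \<open>\<mu> \<rho> t\<^sub>k\<close>.\<close>

definition flag_energy ::
  "real^'n^'n \<Rightarrow> real \<Rightarrow> real^'n \<Rightarrow> real^'m \<Rightarrow> (nat \<Rightarrow> real^'n) \<Rightarrow> (nat \<Rightarrow> real^'m) \<Rightarrow> nat \<Rightarrow> real" where
  "flag_energy P s \<xi> v z y k =
     (flag_t k)\<^sup>2 / 2 * (norm_mat P (\<xi> - z k))\<^sup>2 + (norm (v - y k))\<^sup>2 / (2 * s)"

lemma flag_energy_nonneg: "s > 0 \<Longrightarrow> 0 \<le> flag_energy P s \<xi> v z y k"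
  by (simp add: flag_energy_def)

text \<open>The energy at \<open>k + 1\<close> has the weight \<open>t\<^sub>k\<^sub>+\<^sub>1\<^sup>2 = t\<^sub>k\<^sup>2 + t\<^sub>k\<^sub>+\<^sub>1\<close> on the \<open>P\<close>-seminorm, whereas the
  iteration itself supplies only \<open>t\<^sub>k\<^sup>2\<close>. The rest comes from the strong convexity term, as
  \<open>t\<^sub>k\<^sub>+\<^sub>1 P \<preceq> 2 t\<^sub>k (\<sigma> / 2) I\<close>. The value \<open>q\<close> is the same for all multipliers \<open>v\<close>, so that \<open>v\<close> can be
  chosen in terms of the iterates afterwards.\<close>

lemma flag_energy_decrease:
  assumes nice: "nice_primal_map \<Psi> \<sigma> A b \<rho> (flag_t k) \<delta> P Q (Prim (flag_t k))"
    and seq: "ergodic_flag_sequence A b Prim \<mu> \<rho> z y"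
    and pos: "\<sigma> > 0" "0 < \<mu>" "\<mu> \<le> 1 + \<delta>" "\<rho> > 0"
    and P: "psd P" "loewner_le P ((\<sigma> / 2) *\<^sub>R mat 1)"
    and \<xi>: "A \<xi> = b" "\<Psi> \<xi> = ereal p" and ninf: "\<Psi> (z (Suc k)) \<noteq> -\<infinity>"
  obtains q where "\<Psi> (z (Suc k)) = ereal q"
    and "\<And>v. flag_t k * (q - p + v \<bullet> (A (z (Suc k)) - b))
           \<le> flag_energy P (\<mu> * \<rho>) \<xi> v z y k - flag_energy P (\<mu> * \<rho>) \<xi> v z y (Suc k)"
proof -
  define t where "t = flag_t k"
  define r where "r = A (z (Suc k)) - b"
  define d where "d = \<xi> - z (Suc k)"
  have t: "t > 0" by (simp add: t_def flag_t_pos)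
  have z': "z (Suc k) \<in> Prim (flag_t k) (z k) (y k)"
    and y': "y (Suc k) = y k + (\<mu> * \<rho> * t) *\<^sub>R r"
    using seq by (auto simp: ergodic_flag_sequence_def t_def r_def mult.assoc)
  obtain q where q: "\<Psi> (z (Suc k)) = ereal q"
    and est: "q - p + y k \<bullet> r \<le> t * Delta P \<xi> (z k) (z (Suc k)) - \<sigma> / 2 * (norm d)\<^sup>2
           - (1 + \<delta>) * (\<rho> * t) / 2 * (norm r)\<^sup>2"
    using nice_primal_map_finite_estimate[OF nice pos(1) less_imp_le[OF flag_t_pos] z' \<xi> ninf]
    unfolding t_def r_def d_def by metis
  show ?thesis
  proof (rule that[OF q])
    fix v
    define a where "a = ((norm (v - y k))\<^sup>2 - (norm (v - y (Suc k)))\<^sup>2) / (2 * (\<mu> * \<rho>))"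
    have s: "\<mu> * \<rho> * t > 0" using pos t by simp
    have "v \<bullet> r = y k \<bullet> r + a / t + \<mu> * (\<rho> * t) / 2 * (norm r)\<^sup>2"
      using multiplier_step_identity[OF s, of v r "y k"] by (simp add: a_def y' mult.assoc)
    moreover have "\<mu> * (\<rho> * t) / 2 * (norm r)\<^sup>2 \<le> (1 + \<delta>) * (\<rho> * t) / 2 * (norm r)\<^sup>2"
      using pos t by (intro mult_right_mono divide_right_mono) auto
    ultimately have "q - p + v \<bullet> r
        \<le> t * Delta P \<xi> (z k) (z (Suc k)) - \<sigma> / 2 * (norm d)\<^sup>2 + a / t"
      using est by linarith
    then have "t * (q - p + v \<bullet> r)
        \<le> t * (t * Delta P \<xi> (z k) (z (Suc k)) - \<sigma> / 2 * (norm d)\<^sup>2 + a / t)"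
      using t by simp
    also have "\<dots> = t\<^sup>2 / 2 * (norm_mat P (\<xi> - z k))\<^sup>2
        - (t\<^sup>2 / 2 * (norm_mat P d)\<^sup>2 + t * (\<sigma> / 2 * (norm d)\<^sup>2)) + a"
      using t by (simp add: Delta_def d_def field_simps power2_eq_square)
    also have "\<dots> \<le> t\<^sup>2 / 2 * (norm_mat P (\<xi> - z k))\<^sup>2
        - (flag_t (Suc k))\<^sup>2 / 2 * (norm_mat P d)\<^sup>2 + a"
    proof -
      have "flag_t (Suc k) * (norm_mat P d)\<^sup>2 \<le> (2 * t) * (\<sigma> / 2 * (norm d)\<^sup>2)"
        using flag_t_Suc_le[of k] norm_mat_square_le[OF P, of d] t
        by (intro mult_mono) (auto simp: t_def)
      then show ?thesis
        unfolding flag_t_Suc_square t_def[symmetric] by (simp add: algebra_simps add_divide_distrib)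
    qed
    also have "\<dots> = flag_energy P (\<mu> * \<rho>) \<xi> v z y k - flag_energy P (\<mu> * \<rho>) \<xi> v z y (Suc k)"
      by (simp add: flag_energy_def a_def t_def d_def diff_divide_distrib)
    finally show "flag_t k * (q - p + v \<bullet> (A (z (Suc k)) - b))
           \<le> flag_energy P (\<mu> * \<rho>) \<xi> v z y k - flag_energy P (\<mu> * \<rho>) \<xi> v z y (Suc k)"
      by (simp add: t_def r_def)
  qed
qed

section \<open>The ergodic mean\<close>

text \<open>The weights \<open>t\<^sub>k / t\<^sub>N\<^sub>-\<^sub>1\<^sup>2\<close> of the ergodic mean sum to 1. Hence the residual of the mean is the
  mean of the residuals, the value of the mean is at most the mean of the values, and the decreases
  of the energy telescope.\<close>

lemma ergodic_mean_Lagrangian_bound: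
  assumes nice: "\<And>k. nice_primal_map \<Psi> \<sigma> A b \<rho> (flag_t k) \<delta> P Q (Prim (flag_t k))"
    and seq: "ergodic_flag_sequence A b Prim \<mu> \<rho> z y"
    and \<Psi>: "strongly_convex \<sigma> \<Psi>" "\<And>x. \<Psi> x \<noteq> -\<infinity>" and "linear A"
    and pos: "\<sigma> > 0" "0 < \<mu>" "\<mu> \<le> 1 + \<delta>" "\<rho> > 0"
    and P: "psd P" "loewner_le P ((\<sigma> / 2) *\<^sub>R mat 1)"
    and \<xi>: "A \<xi> = b" "\<Psi> \<xi> = ereal p" and "N \<ge> 1"
  obtains q where "\<Psi> (ergodic_mean z N) = ereal q"
    and "\<And>v. q - p + v \<bullet> (A (ergodic_mean z N) - b)
           \<le> 2 / (real N)\<^sup>2 * ((norm_mat P (\<xi> - z 0))\<^sup>2 + (norm (v - y 0))\<^sup>2 / (\<mu> * \<rho>))"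
proof -
  interpret A: linear A by fact
  define f where "f x = real_of_ereal (\<Psi> x)" for x
  define T where "T = (flag_t (N - 1))\<^sup>2"
  define w where "w k = flag_t k / T" for k
  let ?E = "\<lambda>v. flag_energy P (\<mu> * \<rho>) \<xi> v z y"
  have T: "T > 0" unfolding T_def by (intro zero_less_power flag_t_pos)
  have sumT: "(\<Sum>k<N. flag_t k) = T"
    using sum_flag_t[of "N - 1"] \<open>N \<ge> 1\<close> by (simp add: T_def)
  have w: "sum w {..<N} = 1" "\<And>k. 0 \<le> w k"
    using T flag_t_pos by (auto simp: w_def sumT simp flip: sum_divide_distrib intro: less_imp_le)
  have fin: "\<Psi> (z (Suc k)) \<noteq> \<infinity>"
    and step: "flag_t k * (f (z (Suc k)) - p + v \<bullet> (A (z (Suc k)) - b)) \<le> ?E v k - ?E v (Suc k)"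
    for k v
  proof -
    obtain q where "\<Psi> (z (Suc k)) = ereal q"
      and "\<And>v. flag_t k * (q - p + v \<bullet> (A (z (Suc k)) - b)) \<le> ?E v k - ?E v (Suc k)"
      using flag_energy_decrease[OF nice seq pos P \<xi> \<Psi>(2)] by metis
    then show "\<Psi> (z (Suc k)) \<noteq> \<infinity>"
      and "flag_t k * (f (z (Suc k)) - p + v \<bullet> (A (z (Suc k)) - b)) \<le> ?E v k - ?E v (Suc k)"
      by (simp_all add: f_def)
  qed
  have mean: "ergodic_mean z N = (\<Sum>k<N. w k *\<^sub>R z (Suc k))"
    by (simp add: ergodic_mean_def w_def T_def scaleR_sum_right)
  have conv: "convex_on {x. \<Psi> x \<noteq> \<infinity>} f"
    using strongly_convex_imp_convex_on_domain[OF \<Psi>(1) _ \<Psi>(2)] pos(1) by (simp add: f_def[abs_def])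
  have Jensen: "f (ergodic_mean z N) \<le> (\<Sum>k<N. w k * f (z (Suc k)))"
    unfolding mean using \<open>N \<ge> 1\<close> by (intro convex_on_sum[OF _ _ conv]) (auto simp: w fin lessThan_empty_iff)
  have "ergodic_mean z N \<in> {x. \<Psi> x \<noteq> \<infinity>}"
    unfolding mean using conv w fin by (intro convex_sum) (auto simp: convex_on_def)
  then have q: "\<Psi> (ergodic_mean z N) = ereal (f (ergodic_mean z N))"
    using \<Psi>(2)[of "ergodic_mean z N"] unfolding f_def by (cases "\<Psi> (ergodic_mean z N)") auto
  show ?thesis
  proof (rule that[OF q])
    fix v
    have residual: "A (ergodic_mean z N) - b = (\<Sum>k<N. w k *\<^sub>R (A (z (Suc k)) - b))"
      by (simp add: mean A.sum A.scale scaleR_diff_right sum_subtractf w flip: scaleR_sum_left)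
    have "f (ergodic_mean z N) - p + v \<bullet> (A (ergodic_mean z N) - b)
        \<le> (\<Sum>k<N. w k * f (z (Suc k))) - (\<Sum>k<N. w k) * p + (\<Sum>k<N. w k * (v \<bullet> (A (z (Suc k)) - b)))"
      using Jensen by (simp add: w residual inner_sum_right)
    also have "\<dots> = (\<Sum>k<N. w k * (f (z (Suc k)) - p + v \<bullet> (A (z (Suc k)) - b)))"
      by (simp add: sum_distrib_left sum_subtractf sum.distrib algebra_simps)
    also have "\<dots> = (\<Sum>k<N. flag_t k * (f (z (Suc k)) - p + v \<bullet> (A (z (Suc k)) - b))) / T"
      by (simp add: w_def sum_divide_distrib)
    also have "\<dots> \<le> (\<Sum>k<N. ?E v k - ?E v (Suc k)) / T"
      using T step by (intro divide_right_mono sum_mono) auto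
    also have "\<dots> = (?E v 0 - ?E v N) / T"
      by (simp add: sum_lessThan_telescope')
    also have "\<dots> \<le> ?E v 0 / T"
      using T flag_energy_nonneg[of "\<mu> * \<rho>"] pos by (intro divide_right_mono) auto
    also have "\<dots> \<le> ?E v 0 / ((real N)\<^sup>2 / 4)"
    proof (intro divide_left_mono)
      have "(real N / 2)\<^sup>2 \<le> T"
        unfolding T_def using flag_t_ge[of "N - 1"] \<open>N \<ge> 1\<close> by (intro power_mono) (auto simp: of_nat_diff)
      then show "(real N)\<^sup>2 / 4 \<le> T" by (simp add: power_divide)
    qed (use \<open>N \<ge> 1\<close> T flag_energy_nonneg[of "\<mu> * \<rho>"] pos in auto)
    also have "\<dots> = 2 / (real N)\<^sup>2 * ((norm_mat P (\<xi> - z 0))\<^sup>2 + (norm (v - y 0))\<^sup>2 / (\<mu> * \<rho>))"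
      using pos \<open>N \<ge> 1\<close> by (simp add: flag_energy_def field_simps)
    finally show "f (ergodic_mean z N) - p + v \<bullet> (A (ergodic_mean z N) - b)
        \<le> 2 / (real N)\<^sup>2 * ((norm_mat P (\<xi> - z 0))\<^sup>2 + (norm (v - y 0))\<^sup>2 / (\<mu> * \<rho>))" .
  qed
qed

theorem corollary4p1:
  fixes \<Psi> :: "real^'n \<Rightarrow> ereal"
    and A :: "real^'n \<Rightarrow> real^'m"
    and b :: "real^'m"
    and Prim :: "real \<Rightarrow> real^'n \<Rightarrow> real^'m \<Rightarrow> (real^'n) set"
    and P Q :: "real^'n^'n"
    and \<sigma> \<delta> \<mu> \<rho> c :: real
    and z :: "nat \<Rightarrow> real^'n" and y :: "nat \<Rightarrow> real^'m"
    and zs :: "real^'n" and ys :: "real^'m"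
    and N :: nat
  assumes "proper \<Psi>" and "lower_semicontinuous \<Psi>" and "strongly_convex \<sigma> \<Psi>"
    and "linear A"
    and "\<exists>x' y'. saddle_point \<Psi> A b x' y'"
    and "dual_optimal_solution \<Psi> A b ys" and "c > 0" and "c \<ge> 2 * norm ys"
    and "\<sigma> > 0"
    and "0 < \<delta>" and "\<delta> \<le> 1" and "psd P" and "psd Q"
    and "0 < \<mu>" and "\<mu> \<le> 1 + \<delta>" and "\<rho> > 0"
    and "\<And>k. nice_primal_map \<Psi> \<sigma> A b \<rho> (flag_t k) \<delta> P Q (Prim (flag_t k))"
    and "ergodic_flag_sequence A b Prim \<mu> \<rho> z y"
    and "loewner_le 0 P" and "loewner_le P ((\<sigma> / 2) *\<^sub>R mat 1)"
    and "optimal_solution \<Psi> A b zs"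
    and "N \<ge> 1"
  shows "\<Psi> (ergodic_mean z N) - \<Psi> zs \<le> ereal (B_const P \<mu> \<rho> c (z 0) (y 0) zs / (2 * (real N)\<^sup>2))
       \<and> norm (A (ergodic_mean z N) - b) \<le> B_const P \<mu> \<rho> c (z 0) (y 0) zs / (c * (real N)\<^sup>2)"
proof -
  let ?x = "ergodic_mean z N" and ?B = "B_const P \<mu> \<rho> c (z 0) (y 0) zs"
  define r where "r = A ?x - b"
  have ninf: "\<Psi> x \<noteq> -\<infinity>" for x using assms(1) by (auto simp: proper_def)
  obtain x' y' where sp: "saddle_point \<Psi> A b x' y'" using assms(5) by blast
  note dual = optimal_value_le_Lagrangian[OF assms(1) sp assms(6,21)]
  obtain p where p: "\<Psi> zs = ereal p" using dual(1) ninf[of zs] by (cases "\<Psi> zs") auto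
  have zs: "A zs = b" using assms(21) by (simp add: optimal_solution_def feasible_def)
  obtain q where q: "\<Psi> ?x = ereal q"
    and bound: "\<And>v. q - p + v \<bullet> r
      \<le> 2 / (real N)\<^sup>2 * ((norm_mat P (zs - z 0))\<^sup>2 + (norm (v - y 0))\<^sup>2 / (\<mu> * \<rho>))"
    unfolding r_def
    using ergodic_mean_Lagrangian_bound[OF assms(17,18,3) ninf assms(4,9,14,15,16,12,20) zs p assms(22)]
    by metis
  \<comment> \<open>a maximizer of \<open>v \<bullet> r\<close> over the ball of radius \<open>c\<close>\<close>
  define v where "v = c *\<^sub>R sgn r"
  have "v \<bullet> r = c * norm r"
    by (cases "r = 0") (simp_all add: v_def sgn_div_norm dot_square_norm power2_eq_square)
  moreover have "(norm (v - y 0))\<^sup>2 \<le> (norm (y 0) + c)\<^sup>2"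
  proof (rule power_mono)
    have "norm v \<le> c" using \<open>c > 0\<close> by (simp add: v_def norm_sgn)
    then show "norm (v - y 0) \<le> norm (y 0) + c" using norm_triangle_ineq4[of v "y 0"] by linarith
  qed simp
  then have "2 / (real N)\<^sup>2 * ((norm_mat P (zs - z 0))\<^sup>2 + (norm (v - y 0))\<^sup>2 / (\<mu> * \<rho>))
      \<le> 2 / (real N)\<^sup>2 * ((norm_mat P (zs - z 0))\<^sup>2 + (norm (y 0) + c)\<^sup>2 / (\<mu> * \<rho>))"
    using \<open>0 < \<mu>\<close> \<open>\<rho> > 0\<close> by (intro mult_left_mono add_left_mono divide_right_mono) auto
  moreover have "\<dots> = ?B / (2 * (real N)\<^sup>2)"
    using \<open>0 < \<mu>\<close> \<open>\<rho> > 0\<close> \<open>N \<ge> 1\<close> by (simp add: B_const_def field_simps)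
  ultimately have main: "q - p + c * norm r \<le> ?B / (2 * (real N)\<^sup>2)"
    using bound[of v] by linarith
  \<comment> \<open>strong duality limits how far the objective can fall below the optimal value\<close>
  have "p \<le> q + ys \<bullet> r"
    using dual(2)[of ?x] by (simp add: Lagrangian_def p q r_def)
  moreover have "ys \<bullet> r \<le> c / 2 * norm r"
    using norm_cauchy_schwarz[of ys r] mult_right_mono[OF \<open>c \<ge> 2 * norm ys\<close>, of "norm r"] by simp
  ultimately have "c / 2 * norm r \<le> ?B / (2 * (real N)\<^sup>2)"
    using main by simp
  then have "norm r \<le> ?B / (c * (real N)\<^sup>2)"
    using \<open>c > 0\<close> \<open>N \<ge> 1\<close> by (simp add: field_simps)
  moreover have "q - p \<le> ?B / (2 * (real N)\<^sup>2)"
    using main mult_nonneg_nonneg[OF less_imp_le[OF \<open>c > 0\<close>], of "norm r"] by simp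
  ultimately show ?thesis by (simp add: p q r_def)
qed

end
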